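(* There is a universal constant $c>0$ such that the following holds. For any $B\ge1$, there exist a pair $(P,Q)$ of source and target distributions with $B$-bounded likelihood ratio (i.e. $\sup_{x}\rho(x)\le B$ where $\rho=q/p$) and an orthonormal basis $\{\phi_j\}_{j\ge1}$ of $L^2(Q)$ such that for any regular sequence of kernel eigenvalues $\{\mu_j\}_{j\ge1}$, $$\inf_{\hat f}\ \sup_{f^\star\in\mathcal B_{\mathcal H}(1)}\mathbb E\big[\|\hat f-f^\star\|_Q^2\big]\ \ge\ c\ \inf_{\delta>0}\Big\{\delta^2+\sigma^2B\,\frac{d(\delta)}{n}\Big\}.$$ Here $\mathcal H$ is the Hilbert space with eigenfunctions $\{\phi_j\}$ and eigenvalues $\{\mu_j\}$, $\mathcal B_{\mathcal H}(1)=\{f\in\mathcal H:\|f\|_{\mathcal H}\le1\}$, and the infimum is over all estimators $\hat f$ based on the $n$ observations $(x_i,y_i)_{i=1}^n$.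
   Context: Model. $P$ (source) and $Q$ (target) are distributions on a covariate space $\mathcal X$, with densities $p,q$ and likelihood ratio $\rho=q/p$. One observes $n$ i.i.d. pairs $(x_i,y_i)$ with $x_i\sim P$ and $y_i$ drawn from the law of $Y$ given $X=x_i$, where $f^\star(x)=\mathbb E[Y\mid X=x]$; the residuals $w_i=y_i-f^\star(x_i)$ are sub-Gaussian with variance proxy $\sigma^2$. $\|f\|_Q^2=\mathbb E_{X\sim Q}[f(X)^2]$. RKHS. Given $\{\phi_j\}$ orthonormal in $L^2(Q)$ and nonnegative eigenvalues $\{\mu_j\}$, arranged in nonincreasing order, the kernel is $K(x,x')=\sum_j\mu_j\phi_j(x)\phi_j(x')$ and $\mathcal H=\{f=\sum_j\theta_j\phi_j:\ \sum_j\theta_j^2/\mu_j<\infty\}$ with $\|f\|_{\mathcal H}^2=\sum_j\theta_j^2/\mu_j$ (with $\theta_j=0$ when $\mu_j=0$, and $0/0=0$). Regularity. For $\delta>0$, $d(\delta)=\min\{j\ge1:\mu_j\le\delta^2\}$. The eigenvalue sequence is regular if $\sum_{j=d(\delta)+1}^\infty\mu_j\le c_0\,d(\delta)\,\delta^2$ for all $\delta>0$, for some universal constant $c_0>0$.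
   Formalization: The bound is proved for n with σ²B/n ≤ μ_1; without such a condition it is false, e.g. for μ = (ε,0,0,…) with ε < cσ²B/n, where the zero estimator has risk at most ε while the right side is at least cσ²B/n. *)

theory Defs
  imports "HOL-Probability.Probability"
begin

text \<open>Eigenvalues \<open>\<mu> j\<close> and eigenfunctions \<open>\<phi> j\<close> are indexed by \<open>j \<ge> 1\<close>;
  the values at index 0 play no role.\<close>

section \<open>Source and target distributions\<close>

definition probability_density :: "'a measure \<Rightarrow> ('a \<Rightarrow> real) \<Rightarrow> bool" where
  "probability_density M p \<longleftrightarrow>
     p \<in> borel_measurable M \<and> (\<forall>x. 0 \<le> p x) \<and> (\<integral>\<^sup>+x. ennreal (p x) \<partial>M) = 1"

definition distribution_of :: "'a measure \<Rightarrow> ('a \<Rightarrow> real) \<Rightarrow> 'a measure" where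
  "distribution_of M p = density M (\<lambda>x. ennreal (p x))"

text \<open>The first conjunct is needed because \<open>q x / 0 = 0\<close> in HOL.\<close>

definition bounded_likelihood_ratio :: "real \<Rightarrow> ('a \<Rightarrow> real) \<Rightarrow> ('a \<Rightarrow> real) \<Rightarrow> bool" where
  "bounded_likelihood_ratio B p q \<longleftrightarrow>
     (\<forall>x. p x = 0 \<longrightarrow> q x = 0) \<and> (\<forall>x. q x / p x \<le> B)"

section \<open>Orthonormal bases of \<open>L\<^sup>2(Q)\<close>\<close>

definition sq_norm_L2 :: "'a measure \<Rightarrow> ('a \<Rightarrow> real) \<Rightarrow> ennreal" where
  "sq_norm_L2 Q f = (\<integral>\<^sup>+x. ennreal ((f x)\<^sup>2) \<partial>Q)"

definition L2_functions :: "'a measure \<Rightarrow> ('a \<Rightarrow> real) set" where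
  "L2_functions Q = {f \<in> borel_measurable Q. sq_norm_L2 Q f < \<infinity>}"

definition orthonormal_basis_L2 :: "'a measure \<Rightarrow> (nat \<Rightarrow> 'a \<Rightarrow> real) \<Rightarrow> bool" where
  "orthonormal_basis_L2 Q \<phi> \<longleftrightarrow>
     (\<forall>j\<ge>1. \<phi> j \<in> L2_functions Q) \<and>
     (\<forall>i\<ge>1. \<forall>j\<ge>1. (\<integral>x. \<phi> i x * \<phi> j x \<partial>Q) = (if i = j then 1 else 0)) \<and>
     (\<forall>f \<in> L2_functions Q. \<forall>\<epsilon>>0. \<exists>N a.
        sq_norm_L2 Q (\<lambda>x. f x - (\<Sum>j=1..N. a j * \<phi> j x)) < ennreal (\<epsilon>\<^sup>2))"

section \<open>Kernel eigenvalues and the associated Hilbert space\<close>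

definition eigenvalue_dim :: "(nat \<Rightarrow> real) \<Rightarrow> real \<Rightarrow> nat" where
  "eigenvalue_dim \<mu> \<delta> = (LEAST j. 1 \<le> j \<and> \<mu> j \<le> \<delta>\<^sup>2)"

text \<open>Summability makes \<open>\<mu>\<close> tend to 0, so the \<open>LEAST\<close> above is attained for every
  \<open>\<delta> > 0\<close>, and it gives the infinite sum below its usual meaning.\<close>

definition regular_eigenvalues :: "real \<Rightarrow> (nat \<Rightarrow> real) \<Rightarrow> bool" where
  "regular_eigenvalues c\<^sub>0 \<mu> \<longleftrightarrow>
     (\<forall>j\<ge>1. 0 \<le> \<mu> j) \<and>
     (\<forall>i\<ge>1. \<forall>j\<ge>i. \<mu> j \<le> \<mu> i) \<and>
     \<mu> summable_on {1..} \<and>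
     (\<forall>\<delta>>0. (\<Sum>\<^sub>\<infinity>j\<in>{eigenvalue_dim \<mu> \<delta> + 1..}. \<mu> j)
               \<le> c\<^sub>0 * real (eigenvalue_dim \<mu> \<delta>) * \<delta>\<^sup>2)"

definition kernel_converges :: "(nat \<Rightarrow> 'a \<Rightarrow> real) \<Rightarrow> (nat \<Rightarrow> real) \<Rightarrow> bool" where
  "kernel_converges \<phi> \<mu> \<longleftrightarrow>
     (\<forall>x x'. (\<lambda>j. \<mu> j * \<phi> j x * \<phi> j x') summable_on {1..})"

text \<open>Elements of the Hilbert space are functions defined at every point, by pointwise
  convergence of the expansion. Where \<open>\<mu> j = 0\<close> the coefficient vanishes, and the term
  \<open>(\<theta> j)\<^sup>2 / \<mu> j\<close> is \<open>0 / 0 = 0\<close>.\<close>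

definition hilbert_expansion ::
  "(nat \<Rightarrow> 'a \<Rightarrow> real) \<Rightarrow> (nat \<Rightarrow> real) \<Rightarrow> ('a \<Rightarrow> real) \<Rightarrow> (nat \<Rightarrow> real) \<Rightarrow> bool" where
  "hilbert_expansion \<phi> \<mu> f \<theta> \<longleftrightarrow>
     (\<forall>j\<ge>1. \<mu> j = 0 \<longrightarrow> \<theta> j = 0) \<and>
     (\<lambda>j. (\<theta> j)\<^sup>2 / \<mu> j) summable_on {1..} \<and>
     (\<forall>x. ((\<lambda>j. \<theta> j * \<phi> j x) has_sum f x) {1..})"

definition hilbert_ball ::
  "(nat \<Rightarrow> 'a \<Rightarrow> real) \<Rightarrow> (nat \<Rightarrow> real) \<Rightarrow> real \<Rightarrow> ('a \<Rightarrow> real) set" where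
  "hilbert_ball \<phi> \<mu> r =
     {f. \<exists>\<theta>. hilbert_expansion \<phi> \<mu> f \<theta> \<and> (\<Sum>\<^sub>\<infinity>j\<in>{1..}. (\<theta> j)\<^sup>2 / \<mu> j) \<le> r\<^sup>2}"

section \<open>Observations, estimators and minimax risk\<close>

definition centered_sub_gaussian :: "real \<Rightarrow> real measure \<Rightarrow> bool" where
  "centered_sub_gaussian \<sigma> \<nu> \<longleftrightarrow>
     prob_space \<nu> \<and> sets \<nu> = sets borel \<and>
     integrable \<nu> (\<lambda>w. w) \<and> (\<integral>w. w \<partial>\<nu>) = 0 \<and>
     (\<forall>t. integrable \<nu> (\<lambda>w. exp (t * w)) \<and>
          (\<integral>w. exp (t * w) \<partial>\<nu>) \<le> exp (\<sigma>\<^sup>2 * t\<^sup>2 / 2))"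

text \<open>The law of one pair \<open>(x, f x + w)\<close> with \<open>x\<close> distributed as \<open>P\<close> and an independent
  residual \<open>w\<close> distributed as \<open>\<nu>\<close>.\<close>

definition observation_law ::
  "'a measure \<Rightarrow> real measure \<Rightarrow> ('a \<Rightarrow> real) \<Rightarrow> ('a \<times> real) measure" where
  "observation_law P \<nu> f =
     distr (P \<Otimes>\<^sub>M \<nu>) (P \<Otimes>\<^sub>M borel) (\<lambda>(x, w). (x, f x + w))"

definition sample_law ::
  "nat \<Rightarrow> 'a measure \<Rightarrow> real measure \<Rightarrow> ('a \<Rightarrow> real) \<Rightarrow> (nat \<Rightarrow> 'a \<times> real) measure" where
  "sample_law n P \<nu> f = (\<Pi>\<^sub>M i\<in>{..<n}. observation_law P \<nu> f)"

definition estimators ::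
  "nat \<Rightarrow> 'a measure \<Rightarrow> ((nat \<Rightarrow> 'a \<times> real) \<Rightarrow> 'a \<Rightarrow> real) set" where
  "estimators n P =
     {fh. (\<lambda>(D, x). fh D x) \<in> borel_measurable ((\<Pi>\<^sub>M i\<in>{..<n}. P \<Otimes>\<^sub>M borel) \<Otimes>\<^sub>M P)}"

definition risk ::
  "nat \<Rightarrow> 'a measure \<Rightarrow> 'a measure \<Rightarrow> real measure \<Rightarrow>
   ((nat \<Rightarrow> 'a \<times> real) \<Rightarrow> 'a \<Rightarrow> real) \<Rightarrow> ('a \<Rightarrow> real) \<Rightarrow> ennreal" where
  "risk n P Q \<nu> fh f =
     (\<integral>\<^sup>+D. sq_norm_L2 Q (\<lambda>x. fh D x - f x) \<partial>sample_law n P \<nu> f)"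

definition minimax_risk ::
  "nat \<Rightarrow> 'a measure \<Rightarrow> 'a measure \<Rightarrow> real measure \<Rightarrow> ('a \<Rightarrow> real) set \<Rightarrow> ennreal" where
  "minimax_risk n P Q \<nu> F = (INF fh\<in>estimators n P. SUP f\<in>F. risk n P Q \<nu> fh f)"

end

theory Submission imports Defs begin

text \<open>The target puts mass \<open>2\<^sup>-\<^sup>j\<close> on the atom \<open>j \<ge> 1\<close>; the source keeps only a fraction
  \<open>1 / B\<close> of it and moves the rest to the atom 0, where nothing is learnt. The eigenfunctions are the
  normalised indicators of the atoms, so \<open>n\<close> observations with Gaussian noise determine each
  coefficient \<open>\<theta> j\<close> only up to variance \<open>s = \<sigma>\<^sup>2 B / n\<close>. Let \<open>d\<close> be maximal with \<open>d s \<le> \<mu> d\<close>.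
  The functions with coefficients \<open>\<plusminus> \<tau>\<close>, \<open>\<tau>\<^sup>2 = s / 2\<close>, on the first \<open>d\<close> atoms lie in the
  unit ball, and flipping one coordinate leaves the sample laws with Hellinger affinity at least \<open>3 / 4\<close>; Assouad's argument then
  bounds the risk below by \<open>d s / 4\<close>. Taking \<open>\<delta>\<^sup>2 = (d + 1) s\<close> shows that the infimum over \<open>\<delta>\<close> is at
  most \<open>4 d s\<close>.\<close>

section \<open>Two-point testing via the Hellinger affinity\<close>

text \<open>Both measures agree on boxes, where Fubini splits the integral into factors. This
  supplies the likelihood of an i.i.d. sample.\<close>

lemma PiM_density_const:
  assumes "finite I" and R: "sigma_finite_measure R" and S: "sigma_finite_measure (density R h)"
    and h[measurable]: "h \<in> borel_measurable R"
  shows "PiM I (\<lambda>_. density R h) = density (PiM I (\<lambda>_. R)) (\<lambda>z. \<Prod>i\<in>I. h (z i))"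
proof -
  interpret R: product_sigma_finite "\<lambda>_. R" by (rule product_sigma_finite.intro) (rule R)
  interpret S: product_sigma_finite "\<lambda>_. density R h" by (rule product_sigma_finite.intro) (rule S)
  have sets_eq: "sets (PiM I (\<lambda>_. density R h)) = sets (PiM I (\<lambda>_. R))"
    by (intro sets_PiM_cong) auto
  show ?thesis
  proof (rule S.PiM_eqI[symmetric])
    show "finite I" by fact
    show "sets (density (PiM I (\<lambda>_. R)) (\<lambda>z. \<Prod>i\<in>I. h (z i))) = PiM I (\<lambda>_. density R h)"
      using sets_eq by simp
    fix A assume "\<And>i. i \<in> I \<Longrightarrow> A i \<in> sets (density R h)"
    then have A[measurable]: "\<And>i. i \<in> I \<Longrightarrow> A i \<in> sets R" by simp
    have box: "Pi\<^sub>E I A \<in> sets (PiM I (\<lambda>_. R))"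
      using \<open>finite I\<close> A by (intro sets_PiM_I_finite) auto
    have "emeasure (density (PiM I (\<lambda>_. R)) (\<lambda>z. \<Prod>i\<in>I. h (z i))) (Pi\<^sub>E I A)
        = (\<integral>\<^sup>+z. (\<Prod>i\<in>I. h (z i)) * indicator (Pi\<^sub>E I A) z \<partial>PiM I (\<lambda>_. R))"
      using box by (subst emeasure_density) auto
    also have "\<dots> = (\<integral>\<^sup>+z. (\<Prod>i\<in>I. h (z i) * indicator (A i) (z i)) \<partial>PiM I (\<lambda>_. R))"
    proof (rule nn_integral_cong)
      fix z assume "z \<in> space (PiM I (\<lambda>_. R))"
      then have z: "z \<in> extensional I" by (auto simp: space_PiM PiE_def)
      show "(\<Prod>i\<in>I. h (z i)) * indicator (Pi\<^sub>E I A) z = (\<Prod>i\<in>I. h (z i) * indicator (A i) (z i))"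
      proof (cases "z \<in> Pi\<^sub>E I A")
        case True
        then show ?thesis by (auto simp: PiE_iff intro!: prod.cong)
      next
        case False
        \<comment> \<open>Since \<open>z\<close> is extensional, leaving the box means that some
          coordinate in \<open>I\<close> leaves its side, and the corresponding factor
          vanishes.\<close>
        then obtain i where "i \<in> I" "z i \<notin> A i" using z by (auto simp: PiE_iff)
        then have "(\<Prod>i\<in>I. h (z i) * indicator (A i) (z i)) = 0"
          using \<open>finite I\<close> by (intro prod_zero) (auto intro!: bexI[of _ i])
        then show ?thesis using False by simp
      qed
    qed
    also have "\<dots> = (\<Prod>i\<in>I. \<integral>\<^sup>+y. h y * indicator (A i) y \<partial>R)"
      using \<open>finite I\<close> A by (intro R.product_nn_integral_prod) auto
    also have "\<dots> = (\<Prod>i\<in>I. emeasure (density R h) (A i))"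
      using A by (intro prod.cong) (auto simp: emeasure_density)
    finally show "emeasure (density (PiM I (\<lambda>_. R)) (\<lambda>z. \<Prod>i\<in>I. h (z i))) (Pi\<^sub>E I A)
        = (\<Prod>i\<in>I. emeasure (density R h) (A i))" .
  qed
qed

text \<open>Minimising over \<open>t\<close> turns the two weighted losses into
  \<open>(u - v)^2 * p * q / (p + q)\<close>. Together with the correction
  \<open>(u - v)^2 * (p + q) / 4\<close>, AM-GM yields the geometric mean
  \<open>sqrt (p * q)\<close>.\<close>

lemma two_point_pointwise:
  fixes p q t u v :: real
  assumes "0 \<le> p" "0 \<le> q"
  shows "(u - v)\<^sup>2 * sqrt (p * q) \<le> (t - u)\<^sup>2 * p + (t - v)\<^sup>2 * q + (u - v)\<^sup>2 / 4 * (p + q)"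
proof (cases "p + q = 0")
  case True
  then have "p = 0" "q = 0" using assms by auto
  then show ?thesis by simp
next
  case False
  then have pos: "p + q > 0" using assms by auto
  define s where "s = sqrt (p * q)"
  have s: "s\<^sup>2 = p * q" using assms by (simp add: s_def)
  \<comment> \<open>After multiplication by \<open>p + q\<close> the gap is a completed square in
    \<open>t\<close>, the AM-GM square, and a term that vanishes because \<open>s\<close> is the
    root of \<open>p * q\<close>.\<close>
  have "(p + q) * ((t - u)\<^sup>2 * p + (t - v)\<^sup>2 * q + (u - v)\<^sup>2 / 4 * (p + q) - (u - v)\<^sup>2 * s)
      = ((t - u) * p + (t - v) * q)\<^sup>2 + (u - v)\<^sup>2 * ((p + q) / 2 - s)\<^sup>2 + (u - v)\<^sup>2 * (p * q - s\<^sup>2)"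
    by (simp add: power2_eq_square field_simps)
  also have "\<dots> \<ge> 0" using s by simp
  finally have "0 \<le> (t - u)\<^sup>2 * p + (t - v)\<^sup>2 * q + (u - v)\<^sup>2 / 4 * (p + q) - (u - v)\<^sup>2 * s"
    using pos by (simp add: zero_le_mult_iff)
  then show ?thesis by (simp add: s_def)
qed

text \<open>Le Cam's two-point method for squared loss: \<open>T\<close> estimates a parameter equal
  to \<open>u\<close> under \<open>p\<close> and to \<open>v\<close> under \<open>q\<close>.
  Integrating the pointwise inequality, the affinity 3/4 minus the correction 1/2 leaves the factor
  1/4.\<close>

lemma two_point_risk_bound:
  fixes p q T :: "'b \<Rightarrow> real"
  assumes [measurable]: "p \<in> borel_measurable R" "q \<in> borel_measurable R" "T \<in> borel_measurable R"
    and nn: "\<And>z. 0 \<le> p z" "\<And>z. 0 \<le> q z"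
    and p1: "(\<integral>\<^sup>+z. p z \<partial>R) = 1" and q1: "(\<integral>\<^sup>+z. q z \<partial>R) = 1"
    and aff: "ennreal (3/4) \<le> (\<integral>\<^sup>+z. sqrt (p z * q z) \<partial>R)"
  shows "ennreal ((u - v)\<^sup>2 / 4) \<le> (\<integral>\<^sup>+z. ennreal ((T z - u)\<^sup>2) \<partial>density R p)
      + (\<integral>\<^sup>+z. ennreal ((T z - v)\<^sup>2) \<partial>density R q)" (is "_ \<le> ?A + ?B")
proof -
  define D where "D = (u - v)\<^sup>2"
  have D: "0 \<le> D" by (simp add: D_def)
  have "ennreal (D * (3/4)) = ennreal D * ennreal (3/4)"
    using D by (intro ennreal_mult) auto
  also have "\<dots> \<le> ennreal D * (\<integral>\<^sup>+z. sqrt (p z * q z) \<partial>R)"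
    by (intro mult_left_mono aff) simp
  also have "\<dots> = (\<integral>\<^sup>+z. ennreal (D * sqrt (p z * q z)) \<partial>R)"
    using D nn by (simp add: ennreal_mult nn_integral_cmult)
  also have "\<dots> \<le> (\<integral>\<^sup>+z. ennreal (p z) * ennreal ((T z - u)\<^sup>2) + ennreal (q z) * ennreal ((T z - v)\<^sup>2)
        + ennreal (D / 4) * (ennreal (p z) + ennreal (q z)) \<partial>R)"
  proof (rule nn_integral_mono)
    fix z
    have "ennreal (p z) * ennreal ((T z - u)\<^sup>2) + ennreal (q z) * ennreal ((T z - v)\<^sup>2)
        + ennreal (D / 4) * (ennreal (p z) + ennreal (q z))
      = ennreal ((T z - u)\<^sup>2 * p z + (T z - v)\<^sup>2 * q z + D / 4 * (p z + q z))"
      using nn D by (simp add: ennreal_mult[symmetric] ennreal_plus[symmetric] mult.commute del: ennreal_plus)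
    then show "ennreal (D * sqrt (p z * q z)) \<le> ennreal (p z) * ennreal ((T z - u)\<^sup>2)
        + ennreal (q z) * ennreal ((T z - v)\<^sup>2) + ennreal (D / 4) * (ennreal (p z) + ennreal (q z))"
      using two_point_pointwise[OF nn(1)[of z] nn(2)[of z], of u v "T z"]
      by (simp add: D_def ennreal_leI)
  qed
  also have "\<dots> = ?A + ?B + ennreal (D / 2)"
  proof -
    have "ennreal (D / 4) * (1 + 1) = ennreal (D / 4) + ennreal (D / 4)"
      by (simp only: distrib_left mult_1_right)
    also have "\<dots> = ennreal (D / 2)"
      using D by (subst ennreal_plus[symmetric]) auto
    finally have "ennreal (D / 4) * (1 + 1) = ennreal (D / 2)" .
    then show ?thesis
      by (simp add: nn_integral_add nn_integral_cmult nn_integral_density p1 q1)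
  qed
  finally have *: "ennreal (D * (3/4)) \<le> ?A + ?B + ennreal (D / 2)" .
  \<comment> \<open>Cancelling \<open>D / 2\<close> requires a finite total risk; an infinite one
    satisfies the bound trivially.\<close>
  show ?thesis
  proof (cases "?A + ?B")
    case (real r)
    then have "ennreal (D * (3/4)) \<le> ennreal (r + D / 2)"
      using * D by (simp add: ennreal_plus)
    then have "D * (3/4) \<le> r + D / 2" using real D by (subst (asm) ennreal_le_iff) auto
    then show ?thesis using real by (simp add: D_def ennreal_leI)
  next
    case top
    show ?thesis unfolding top by (rule top_greatest)
  qed
qed

section \<open>Gaussian noise and the law of a regression sample\<close>

text \<open>Completing the square shows that the geometric mean of two normal densities of equal
  variance is a multiple of the normal density centred at the midpoint.\<close>

lemma normal_density_affinity:
  assumes "\<sigma> > 0"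
  shows "(\<integral>\<^sup>+y. ennreal (sqrt (normal_density a \<sigma> y * normal_density b \<sigma> y)) \<partial>lborel)
    = ennreal (exp (- (a - b)\<^sup>2 / (8 * \<sigma>\<^sup>2)))"
proof -
  have eq: "sqrt (normal_density a \<sigma> y * normal_density b \<sigma> y)
      = exp (- (a - b)\<^sup>2 / (8 * \<sigma>\<^sup>2)) * normal_density ((a + b) / 2) \<sigma> y" for y
  proof (rule real_sqrt_unique)
    have e: "- (y - a)\<^sup>2 / (2 * \<sigma>\<^sup>2) + - (y - b)\<^sup>2 / (2 * \<sigma>\<^sup>2)
        = 2 * (- (a - b)\<^sup>2 / (8 * \<sigma>\<^sup>2)) + 2 * (- (y - (a + b) / 2)\<^sup>2 / (2 * \<sigma>\<^sup>2))"
      using assms by (simp add: field_simps power2_eq_square)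
    have "normal_density a \<sigma> y * normal_density b \<sigma> y = (1 / sqrt (2 * pi * \<sigma>\<^sup>2))\<^sup>2
        * exp (- (y - a)\<^sup>2 / (2 * \<sigma>\<^sup>2) + - (y - b)\<^sup>2 / (2 * \<sigma>\<^sup>2))"
      by (simp add: normal_density_def mult_exp_exp power2_eq_square[of "1 / _"])
    also have "\<dots> = (exp (- (a - b)\<^sup>2 / (8 * \<sigma>\<^sup>2)) * normal_density ((a + b) / 2) \<sigma> y)\<^sup>2"
      unfolding e exp_add exp_double normal_density_def power_mult_distrib by (rule mult.left_commute)
    finally show "(exp (- (a - b)\<^sup>2 / (8 * \<sigma>\<^sup>2)) * normal_density ((a + b) / 2) \<sigma> y)\<^sup>2
        = normal_density a \<sigma> y * normal_density b \<sigma> y" by simp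
  qed simp
  have "(\<integral>\<^sup>+y. ennreal (normal_density ((a + b) / 2) \<sigma> y) \<partial>lborel) = 1"
    using assms by (simp add: nn_integral_eq_integral)
  then show ?thesis
    by (simp add: eq ennreal_mult nn_integral_cmult)
qed

text \<open>Exponential tilting by \<open>t\<close> shifts the mean to
  \<open>\<sigma>\<^sup>2 * t\<close>, so the moment generating function attains the sub-Gaussian
  bound with equality.\<close>

lemma normal_centered_sub_gaussian:
  assumes "\<sigma> > 0"
  shows "centered_sub_gaussian \<sigma> (density lborel (normal_density 0 \<sigma>))"
proof -
  have mgf: "exp (t * w) * normal_density 0 \<sigma> w
      = exp (\<sigma>\<^sup>2 * t\<^sup>2 / 2) * normal_density (\<sigma>\<^sup>2 * t) \<sigma> w" for t w
  proof -
    have "t * w + - (w - 0)\<^sup>2 / (2 * \<sigma>\<^sup>2) = \<sigma>\<^sup>2 * t\<^sup>2 / 2 + - (w - \<sigma>\<^sup>2 * t)\<^sup>2 / (2 * \<sigma>\<^sup>2)"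
      using assms by (simp add: field_simps power2_eq_square)
    then have "exp (t * w) * exp (- (w - 0)\<^sup>2 / (2 * \<sigma>\<^sup>2))
        = exp (\<sigma>\<^sup>2 * t\<^sup>2 / 2) * exp (- (w - \<sigma>\<^sup>2 * t)\<^sup>2 / (2 * \<sigma>\<^sup>2))"
      by (simp only: exp_add[symmetric])
    then show ?thesis by (simp add: normal_density_def)
  qed
  show ?thesis
    unfolding centered_sub_gaussian_def
  proof (intro conjI allI)
    show "prob_space (density lborel (normal_density 0 \<sigma>))"
      using assms by (rule prob_space_normal_density)
    show "integrable (density lborel (normal_density 0 \<sigma>)) (\<lambda>w. w)"
      using integrable_normal_moment_nz_1[OF assms, of 0] by (simp add: integrable_density)
    show "(\<integral>w. w \<partial>density lborel (normal_density 0 \<sigma>)) = 0"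
      using integral_normal_moment_nz_1[OF assms, of 0] by (simp add: integral_density)
    fix t
    have eq: "(\<lambda>w. normal_density 0 \<sigma> w * exp (t * w))
        = (\<lambda>w. exp (\<sigma>\<^sup>2 * t\<^sup>2 / 2) * normal_density (\<sigma>\<^sup>2 * t) \<sigma> w)"
      using mgf[of t] by (auto simp: mult.commute)
    show "integrable (density lborel (normal_density 0 \<sigma>)) (\<lambda>w. exp (t * w))"
      using assms by (simp add: integrable_density eq)
    show "(\<integral>w. exp (t * w) \<partial>density lborel (normal_density 0 \<sigma>)) \<le> exp (\<sigma>\<^sup>2 * t\<^sup>2 / 2)"
      using assms by (simp add: integral_density eq)
  qed simp
qed

lemma point_mass_centered_sub_gaussian: "centered_sub_gaussian 0 (return borel 0)"
  by (auto simp: centered_sub_gaussian_def prob_space_return integral_return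
      integrable_iff_bounded nn_integral_return)

text \<open>For fixed \<open>x\<close>, adding \<open>f x\<close> translates the noise density. All
  regression functions thus have laws dominated by one measure, which makes affinities
  computable.\<close>

lemma observation_law_normal:
  assumes P: "prob_space P" and [measurable]: "f \<in> borel_measurable P"
  shows "observation_law P (density lborel (normal_density 0 \<sigma>)) f
    = density (P \<Otimes>\<^sub>M lborel) (\<lambda>z. normal_density (f (fst z)) \<sigma> (snd z))"
proof (rule measure_eqI)
  interpret P: prob_space P by fact
  interpret N: sigma_finite_measure "density lborel (normal_density 0 \<sigma>)"
    by (subst sigma_finite_measure.sigma_finite_iff_density_finite) (auto intro: sigma_finite_lborel)
  show "sets (observation_law P (density lborel (normal_density 0 \<sigma>)) f)
     = sets (density (P \<Otimes>\<^sub>M lborel) (\<lambda>z. normal_density (f (fst z)) \<sigma> (snd z)))"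
    by (simp add: observation_law_def)
  fix A assume "A \<in> sets (observation_law P (density lborel (normal_density 0 \<sigma>)) f)"
  then have A[measurable]: "A \<in> sets (P \<Otimes>\<^sub>M borel)" by (simp add: observation_law_def)
  have A'[measurable]: "A \<in> sets (P \<Otimes>\<^sub>M lborel)" by (simp add: A)
  have "emeasure (observation_law P (density lborel (normal_density 0 \<sigma>)) f) A
      = (\<integral>\<^sup>+z. indicator A z \<partial>observation_law P (density lborel (normal_density 0 \<sigma>)) f)"
    using A by (subst nn_integral_indicator) (auto simp: observation_law_def)
  also have "\<dots> = (\<integral>\<^sup>+z. indicator A (fst z, f (fst z) + snd z) \<partial>(P \<Otimes>\<^sub>M density lborel (normal_density 0 \<sigma>)))"
    unfolding observation_law_def
    by (subst nn_integral_distr) (auto simp: split_beta intro!: nn_integral_cong)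
  also have "\<dots> = (\<integral>\<^sup>+x. (\<integral>\<^sup>+w. indicator A (x, f x + w) \<partial>density lborel (normal_density 0 \<sigma>)) \<partial>P)"
    by (subst N.nn_integral_fst[symmetric]) auto
  also have "\<dots> = (\<integral>\<^sup>+x. (\<integral>\<^sup>+y. ennreal (normal_density (f x) \<sigma> y) * indicator A (x, y) \<partial>lborel) \<partial>P)"
  proof (rule nn_integral_cong)
    fix x assume x[measurable]: "x \<in> space P"
    have m: "(\<lambda>y. indicator A (x, y) :: ennreal) \<in> borel_measurable borel" by measurable
    have "(\<integral>\<^sup>+w. indicator A (x, f x + w) \<partial>density lborel (normal_density 0 \<sigma>))
      = (\<integral>\<^sup>+w. ennreal (normal_density 0 \<sigma> w) * indicator A (x, f x + w) \<partial>lborel)"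
      by (subst nn_integral_density) auto
    also have "\<dots> = (\<integral>\<^sup>+y. ennreal (normal_density (f x) \<sigma> y) * indicator A (x, y) \<partial>lborel)"
      using m by (subst nn_integral_real_affine[where c = 1 and t = "f x"
          and f = "\<lambda>y. ennreal (normal_density (f x) \<sigma> y) * indicator A (x, y)"])
        (auto simp: normal_density_def)
    finally show "(\<integral>\<^sup>+w. indicator A (x, f x + w) \<partial>density lborel (normal_density 0 \<sigma>))
      = (\<integral>\<^sup>+y. ennreal (normal_density (f x) \<sigma> y) * indicator A (x, y) \<partial>lborel)" .
  qed
  also have "\<dots> = (\<integral>\<^sup>+z. ennreal (normal_density (f (fst z)) \<sigma> (snd z)) * indicator A z \<partial>(P \<Otimes>\<^sub>M lborel))"
    by (subst lborel.nn_integral_fst[symmetric]) (auto simp: normal_density_def)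
  also have "\<dots> = emeasure (density (P \<Otimes>\<^sub>M lborel) (\<lambda>z. normal_density (f (fst z)) \<sigma> (snd z))) A"
    by (subst emeasure_density) (auto simp: normal_density_def)
  finally show "emeasure (observation_law P (density lborel (normal_density 0 \<sigma>)) f) A
    = emeasure (density (P \<Otimes>\<^sub>M lborel) (\<lambda>z. normal_density (f (fst z)) \<sigma> (snd z))) A" .
qed

text \<open>The affinity at fixed \<open>x\<close> is \<open>exp (- t)\<close> with
  \<open>t = (f x - g x)^2 / (8 * \<sigma>\<^sup>2)\<close>. Since
  \<open>exp (- t) >= 1 - t\<close>, its mean is at least 1 minus the mean of \<open>t\<close>,
  which \<open>a\<close> bounds.\<close>

lemma normal_location_affinity:
  assumes P: "prob_space P" and [measurable]: "f \<in> borel_measurable P" "g \<in> borel_measurable P"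
    and \<sigma>: "\<sigma> > 0" and a: "0 \<le> a"
    and close: "(\<integral>\<^sup>+x. ennreal ((f x - g x)\<^sup>2) \<partial>P) \<le> ennreal (8 * \<sigma>\<^sup>2 * a)"
  shows "ennreal (1 - a) \<le> (\<integral>\<^sup>+z. ennreal (sqrt (normal_density (f (fst z)) \<sigma> (snd z)
      * normal_density (g (fst z)) \<sigma> (snd z))) \<partial>(P \<Otimes>\<^sub>M lborel))" (is "_ \<le> ?A")
proof -
  interpret P: prob_space P by fact
  have A: "?A = (\<integral>\<^sup>+x. ennreal (exp (- (f x - g x)\<^sup>2 / (8 * \<sigma>\<^sup>2))) \<partial>P)"
    using \<sigma> by (subst lborel.nn_integral_fst[symmetric])
      (auto simp: normal_density_affinity, auto simp: normal_density_def)
  have "1 = (\<integral>\<^sup>+x. 1 \<partial>P)" by (simp add: P.emeasure_space_1)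
  \<comment> \<open>The additive form \<open>1 <= exp (- t) + t\<close> avoids subtraction in
    \<open>ennreal\<close>.\<close>
  also have "\<dots> \<le> (\<integral>\<^sup>+x. ennreal (exp (- (f x - g x)\<^sup>2 / (8 * \<sigma>\<^sup>2)))
      + ennreal (1 / (8 * \<sigma>\<^sup>2)) * ennreal ((f x - g x)\<^sup>2) \<partial>P)"
  proof (rule nn_integral_mono)
    fix x
    have "1 \<le> exp (- (f x - g x)\<^sup>2 / (8 * \<sigma>\<^sup>2)) + 1 / (8 * \<sigma>\<^sup>2) * (f x - g x)\<^sup>2"
      using exp_ge_add_one_self[of "- (f x - g x)\<^sup>2 / (8 * \<sigma>\<^sup>2)"] by simp
    then have "ennreal 1 \<le> ennreal (exp (- (f x - g x)\<^sup>2 / (8 * \<sigma>\<^sup>2)) + 1 / (8 * \<sigma>\<^sup>2) * (f x - g x)\<^sup>2)"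
      by (rule ennreal_leI)
    then show "1 \<le> ennreal (exp (- (f x - g x)\<^sup>2 / (8 * \<sigma>\<^sup>2)))
      + ennreal (1 / (8 * \<sigma>\<^sup>2)) * ennreal ((f x - g x)\<^sup>2)"
      by (subst ennreal_mult[symmetric], simp, simp, subst ennreal_plus[symmetric]) auto
  qed
  also have "\<dots> = ?A + ennreal (1 / (8 * \<sigma>\<^sup>2)) * (\<integral>\<^sup>+x. ennreal ((f x - g x)\<^sup>2) \<partial>P)"
    unfolding A by (simp add: nn_integral_add nn_integral_cmult)
  also have "\<dots> \<le> ?A + ennreal (1 / (8 * \<sigma>\<^sup>2)) * ennreal (8 * \<sigma>\<^sup>2 * a)"
    by (intro add_left_mono mult_left_mono close) simp
  also have "ennreal (1 / (8 * \<sigma>\<^sup>2)) * ennreal (8 * \<sigma>\<^sup>2 * a) = ennreal a"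
    using \<sigma> a by (subst ennreal_mult[symmetric]) auto
  finally have *: "1 \<le> ?A + ennreal a" .
  show ?thesis
  proof (cases ?A)
    case (real r)
    then have "ennreal 1 \<le> ennreal (r + a)" using * a by (simp add: ennreal_plus)
    then have "1 \<le> r + a" using real a by (subst (asm) ennreal_le_iff) auto
    then show ?thesis using real by (simp add: ennreal_leI)
  qed simp
qed

text \<open>Affinity is multiplicative over independent observations. An affinity of at least
  \<open>1 - 1 / (4 * n)\<close> per observation leaves at least 3/4 for the whole sample, by
  Bernoulli's inequality.\<close>

lemma sample_two_point_bound:
  assumes P: "prob_space P" and f[measurable]: "f \<in> borel_measurable P"
    and g[measurable]: "g \<in> borel_measurable P"
    and \<sigma>: "\<sigma> > 0" and n: "n \<ge> 1"
    and close: "(\<integral>\<^sup>+x. ennreal ((f x - g x)\<^sup>2) \<partial>P) \<le> ennreal (2 * \<sigma>\<^sup>2 / real n)"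
    and T: "T \<in> borel_measurable (\<Pi>\<^sub>M i\<in>{..<n}. P \<Otimes>\<^sub>M borel)"
  defines "\<nu> \<equiv> density lborel (normal_density 0 \<sigma>)"
  shows "ennreal ((u - v)\<^sup>2 / 4) \<le> (\<integral>\<^sup>+D. ennreal ((T D - u)\<^sup>2) \<partial>sample_law n P \<nu> f)
      + (\<integral>\<^sup>+D. ennreal ((T D - v)\<^sup>2) \<partial>sample_law n P \<nu> g)"
proof -
  interpret P: prob_space P by fact
  interpret R1: pair_sigma_finite P lborel ..
  define R where "R = (P \<Otimes>\<^sub>M (lborel :: real measure))"
  \<comment> \<open>\<open>k\<close> is the likelihood of one observation and \<open>L\<close> that
    of the sample, relative to the common dominating measure \<open>R\<close> and its
    \<open>n\<close>-fold power.\<close>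
  define k where "k f z = normal_density (f (fst z)) \<sigma> (snd z)" for f :: "'a \<Rightarrow> real" and z
  define L where "L f D = (\<Prod>i<n. k f (D i))" for f :: "'a \<Rightarrow> real" and D
  have sfR: "sigma_finite_measure R" unfolding R_def by (rule R1.sigma_finite_measure_axioms)
  interpret R: product_sigma_finite "\<lambda>_::nat. R" by (rule product_sigma_finite.intro) (rule sfR)
  have k_meas[measurable]: "k h \<in> borel_measurable R" if [measurable]: "h \<in> borel_measurable P" for h
    unfolding k_def R_def normal_density_def by measurable
  have k_nn: "0 \<le> k h z" for h z by (simp add: k_def)
  have L_nn: "0 \<le> L h z" for h z by (simp add: L_def prod_nonneg k_nn)
  have L_meas[measurable]: "L h \<in> borel_measurable (PiM {..<n} (\<lambda>_. R))"
    if [measurable]: "h \<in> borel_measurable P" for h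
    unfolding L_def by measurable
  have k_int: "(\<integral>\<^sup>+z. ennreal (k h z) \<partial>R) = 1" if [measurable]: "h \<in> borel_measurable P" for h
    unfolding R_def k_def
  proof (subst lborel.nn_integral_fst[symmetric])
    show "(\<lambda>z. ennreal (normal_density (h (fst z)) \<sigma> (snd z))) \<in> borel_measurable (P \<Otimes>\<^sub>M lborel)"
      unfolding normal_density_def by measurable
    show "(\<integral>\<^sup>+x. \<integral>\<^sup>+y. ennreal (normal_density (h (fst (x, y))) \<sigma> (snd (x, y))) \<partial>lborel \<partial>P) = 1"
      using \<sigma> by (simp add: nn_integral_eq_integral P.emeasure_space_1)
  qed
  have L_int: "(\<integral>\<^sup>+z. ennreal (L h z) \<partial>PiM {..<n} (\<lambda>_. R)) = 1"
    if [measurable]: "h \<in> borel_measurable P" for h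
    unfolding L_def using k_int[OF that] that
    by (simp add: prod_ennreal[symmetric] k_nn
        R.product_nn_integral_prod[of "{..<n}" "\<lambda>_ z. ennreal (k h z)"])
  have law: "sample_law n P \<nu> h = density (PiM {..<n} (\<lambda>_. R)) (L h)"
    if h[measurable]: "h \<in> borel_measurable P" for h
  proof -
    have "prob_space (density R (k h))"
      by (rule prob_spaceI) (simp add: emeasure_density k_int cong: nn_integral_cong)
    then have sf: "sigma_finite_measure (density R (k h))"
      by (simp add: prob_space_imp_sigma_finite)
    have "sample_law n P \<nu> h = PiM {..<n} (\<lambda>_. density R (k h))"
      unfolding sample_law_def \<nu>_def observation_law_normal[OF P h] R_def k_def ..
    also have "\<dots> = density (PiM {..<n} (\<lambda>_. R)) (\<lambda>z. \<Prod>i<n. ennreal (k h (z i)))"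
      by (rule PiM_density_const) (auto simp: sfR sf)
    finally show ?thesis by (simp add: L_def prod_ennreal k_nn)
  qed
  \<comment> \<open>Measurability of \<open>T\<close> is given for \<open>borel\<close>, while
    \<open>R\<close> is built with \<open>lborel\<close>; the sigma-algebras coincide.\<close>
  have T'[measurable]: "T \<in> borel_measurable (PiM {..<n} (\<lambda>_. R))"
  proof -
    have "sets (PiM {..<n} (\<lambda>_. R)) = sets (\<Pi>\<^sub>M i\<in>{..<n}. P \<Otimes>\<^sub>M borel)"
      unfolding R_def by (intro sets_PiM_cong sets_pair_measure_cong) auto
    then show ?thesis using T measurable_cong_sets by blast
  qed
  \<comment> \<open>Chosen so that \<open>8 * \<sigma>\<^sup>2 * a\<close> is the bound in
    \<open>close\<close> and \<open>n * a\<close> is 1/4.\<close>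
  define a where "a = 1 / (4 * real n)"
  have a: "0 \<le> a" "a \<le> 1" "real n * a = 1 / 4" using n by (auto simp: a_def field_simps)
  have aff1: "ennreal (1 - a) \<le> (\<integral>\<^sup>+z. ennreal (sqrt (k f z * k g z)) \<partial>R)"
    unfolding R_def k_def
    by (rule normal_location_affinity[OF P f g \<sigma> a(1)]) (use close in \<open>simp add: a_def\<close>)
  have sqrt_prod: "(\<Prod>i<m. sqrt (h i)) = sqrt (\<Prod>i<m. h i)" for h :: "nat \<Rightarrow> real" and m
    by (induction m) (auto simp: real_sqrt_mult)
  have "3 / 4 \<le> (1 - a) ^ n"
    using Bernoulli_inequality[of "- a" n] a by simp
  then have "ennreal (3 / 4) \<le> ennreal (1 - a) ^ n"
    using a by (simp add: ennreal_power ennreal_leI)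
  also have "\<dots> \<le> (\<integral>\<^sup>+z. ennreal (sqrt (k f z * k g z)) \<partial>R) ^ n"
    by (intro power_mono aff1) simp
  also have "\<dots> = (\<integral>\<^sup>+D. (\<Prod>i<n. ennreal (sqrt (k f (D i) * k g (D i)))) \<partial>PiM {..<n} (\<lambda>_. R))"
    by (subst R.product_nn_integral_prod) auto
  also have "\<dots> = (\<integral>\<^sup>+D. sqrt (L f D * L g D) \<partial>PiM {..<n} (\<lambda>_. R))"
    by (simp add: L_def prod_ennreal k_nn sqrt_prod prod.distrib)
  finally show ?thesis
    unfolding law[OF f] law[OF g]
    by (intro two_point_risk_bound) (auto simp: L_nn L_int)
qed

section \<open>A pair of atomic distributions\<close>

text \<open>Atom \<open>k\<close>, counted from 0, has mass \<open>(1/2) ^ Suc k\<close>, so atom 0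
  and the positive atoms together each carry 1/2. It dominates both the source and the
  target.\<close>

definition geometric_base :: "real measure" where
  "geometric_base = distr (measure_pmf (geometric_pmf (1/2))) borel real"

text \<open>The threshold 1/2 separates atom 0 from the others. The factors 2 undo the base mass 1/2
  of each side, so the positive atoms receive \<open>1 / B\<close> in total.\<close>

definition source_density :: "real \<Rightarrow> real \<Rightarrow> real" where
  "source_density B x = (if x < 1/2 then 2 * (1 - 1 / B) else 2 / B)"

definition target_density :: "real \<Rightarrow> real" where
  "target_density x = (if x < 1/2 then 0 else 2)"

definition spike :: "nat \<Rightarrow> real \<Rightarrow> real" where
  "spike j x = (if x = real j then sqrt (2 ^ j) else 0)"

lemma prob_space_base: "prob_space geometric_base"
  unfolding geometric_base_def by (rule prob_space.prob_space_distr) (auto simp: measure_pmf.prob_space_axioms)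

lemma sets_base [measurable_cong, simp]: "sets geometric_base = sets borel"
  by (simp add: geometric_base_def)

lemma space_base [simp]: "space geometric_base = UNIV"
  by (simp add: geometric_base_def)

lemma measurable_spike [measurable]: "spike j \<in> borel_measurable borel"
  unfolding spike_def by measurable

lemma measurable_source [measurable]: "source_density B \<in> borel_measurable borel"
  unfolding source_density_def by measurable

lemma measurable_target [measurable]: "target_density \<in> borel_measurable borel"
  unfolding target_density_def by measurable

lemma target_nonneg [simp]: "0 \<le> target_density x"
  by (simp add: target_density_def)

lemma source_nonneg: "1 \<le> B \<Longrightarrow> 0 \<le> source_density B x"
  by (simp add: source_density_def divide_le_eq)

lemma nn_integral_base:
  assumes [measurable]: "h \<in> borel_measurable borel"
  shows "(\<integral>\<^sup>+x. h x \<partial>geometric_base) = (\<Sum>k. ennreal ((1/2) ^ Suc k) * h (real k))"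
  unfolding geometric_base_def
  by (subst nn_integral_distr)
    (auto simp: nn_integral_measure_pmf nn_integral_count_space_nat mult.commute)

lemma emeasure_base_atom_zero: "emeasure geometric_base {..<1/2} = ennreal (1/2)"
proof -
  have "real -` {..<1/2} = {0}" by auto
  then show ?thesis
    by (simp add: geometric_base_def emeasure_distr emeasure_pmf_single)
qed

lemma emeasure_base_positive: "emeasure geometric_base {1/2..} = ennreal (1/2)"
proof -
  interpret prob_space geometric_base by (rule prob_space_base)
  have "{1/2..} = space geometric_base - {..<1/2::real}" by auto
  moreover have "prob {..<1/2} = 1/2"
    unfolding measure_def emeasure_base_atom_zero by (rule enn2real_ennreal) simp
  ultimately have "prob {1/2..} = 1/2" by (simp add: prob_compl del: space_base)
  then show ?thesis by (simp only: emeasure_eq_measure)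
qed

lemma probability_density_target: "probability_density geometric_base target_density"
proof -
  have "(\<integral>\<^sup>+x. ennreal (target_density x) \<partial>geometric_base) = (\<integral>\<^sup>+x. 2 * indicator {1/2..} x \<partial>geometric_base)"
    by (intro nn_integral_cong) (auto simp: target_density_def)
  also have "\<dots> = 2 * ennreal (1/2)"
    by (simp add: nn_integral_cmult_indicator emeasure_base_positive)
  also have "\<dots> = ennreal (2 * (1/2))" by (subst ennreal_mult) auto
  finally show ?thesis by (simp add: probability_density_def)
qed

lemma probability_density_source:
  assumes B: "1 \<le> B"
  shows "probability_density geometric_base (source_density B)"
proof -
  have "(\<integral>\<^sup>+x. ennreal (source_density B x) \<partial>geometric_base) = (\<integral>\<^sup>+x. ennreal (2 / B) * indicator {1/2..} x
      + ennreal (2 * (1 - 1 / B)) * indicator {..<1/2} x \<partial>geometric_base)"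
    by (intro nn_integral_cong) (auto simp: source_density_def)
  also have "\<dots> = ennreal (2 / B) * ennreal (1/2) + ennreal (2 * (1 - 1 / B)) * ennreal (1/2)"
    by (simp add: nn_integral_add nn_integral_cmult_indicator emeasure_base_positive emeasure_base_atom_zero)
  also have "\<dots> = ennreal (2 / B * (1/2) + 2 * (1 - 1 / B) * (1/2))"
    using B by (subst (1 2) ennreal_mult[symmetric]) (auto simp: divide_le_eq ennreal_plus[symmetric] simp del: ennreal_plus)
  also have "2 / B * (1/2) + 2 * (1 - 1 / B) * (1/2) = 1" by (simp add: field_simps)
  finally show ?thesis using B by (simp add: probability_density_def source_nonneg)
qed

text \<open>The ratio is \<open>B\<close> at and above the threshold and 0 below it. When
  \<open>B = 1\<close> the source density also vanishes below the threshold, as does the target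
  density.\<close>

lemma bounded_likelihood_ratio_source_target:
  "1 \<le> B \<Longrightarrow> bounded_likelihood_ratio B (source_density B) target_density"
  by (auto simp: bounded_likelihood_ratio_def source_density_def target_density_def)

lemma prob_space_distribution_of:
  "probability_density M p \<Longrightarrow> prob_space (distribution_of M p)"
  unfolding probability_density_def distribution_of_def
  by (intro prob_spaceI) (simp add: emeasure_density cong: nn_integral_cong)

lemma sets_distribution_of [measurable_cong, simp]: "sets (distribution_of M p) = sets M"
  by (simp add: distribution_of_def)

text \<open>The density 2 turns the base mass \<open>(1/2) ^ Suc k\<close> into
  \<open>(1/2) ^ k\<close>, and atom 0 is removed.\<close>

lemma nn_integral_target:
  assumes [measurable]: "h \<in> borel_measurable borel"
  shows "(\<integral>\<^sup>+x. h x \<partial>distribution_of geometric_base target_density)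
    = (\<Sum>k. (if k = 0 then 0 else ennreal ((1/2) ^ k)) * h (real k))"
proof -
  have eq: "ennreal ((1/2) ^ Suc k) * (ennreal (target_density (real k)) * h (real k))
      = (if k = 0 then 0 else ennreal ((1/2) ^ k)) * h (real k)" for k
  proof -
    have "ennreal ((1/2) ^ Suc k) * (ennreal (target_density (real k)) * h (real k))
        = ennreal ((1/2) ^ Suc k * target_density (real k)) * h (real k)"
      by (subst ennreal_mult) (auto simp: mult.assoc)
    also have "(1/2) ^ Suc k * target_density (real k) = (if k = 0 then 0 else (1/2) ^ k)"
      by (auto simp: target_density_def)
    finally show ?thesis by auto
  qed
  have "(\<integral>\<^sup>+x. h x \<partial>distribution_of geometric_base target_density) = (\<integral>\<^sup>+x. ennreal (target_density x) * h x \<partial>geometric_base)"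
    unfolding distribution_of_def by (subst nn_integral_density) auto
  also have "\<dots> = (\<Sum>k. ennreal ((1/2) ^ Suc k) * (ennreal (target_density (real k)) * h (real k)))"
    by (subst nn_integral_base) auto
  finally show ?thesis by (simp only: eq)
qed

text \<open>Away from atom 0 the source is the target thinned by \<open>1 / B\<close>. This is how
  covariate shift enters the bound: the effective sample size is \<open>n / B\<close>.\<close>

lemma nn_integral_source:
  assumes [measurable]: "h \<in> borel_measurable borel" and B: "1 \<le> B"
    and h0: "\<And>x. x < 1/2 \<Longrightarrow> h x = 0"
  shows "(\<integral>\<^sup>+x. h x \<partial>distribution_of geometric_base (source_density B))
    = ennreal (1 / B) * (\<integral>\<^sup>+x. h x \<partial>distribution_of geometric_base target_density)"
proof -
  have "ennreal (source_density B x) * h x = ennreal (1 / B) * (ennreal (target_density x) * h x)" for x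
  proof (cases "x < 1/2")
    case True
    then show ?thesis using h0 by simp
  next
    case False
    then have "source_density B x = 1 / B * target_density x" by (simp add: source_density_def target_density_def)
    then show ?thesis using B by (subst mult.assoc[symmetric], subst ennreal_mult[symmetric]) auto
  qed
  then show ?thesis
    unfolding distribution_of_def
    by (simp add: nn_integral_density nn_integral_cmult)
qed

section \<open>Norms under the target and the spike basis\<close>

lemma sq_norm_target:
  assumes [measurable]: "h \<in> borel_measurable borel"
  shows "sq_norm_L2 (distribution_of geometric_base target_density) h
    = (\<Sum>k. ennreal (if k = 0 then 0 else (1/2) ^ k * (h (real k))\<^sup>2))"
  unfolding sq_norm_L2_def
  by (subst nn_integral_target) (auto intro!: suminf_cong simp: ennreal_mult)

text \<open>Bessel's inequality for the spikes: the coefficient of \<open>h\<close> along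
  \<open>spike j\<close> is \<open>h (real j) / sqrt (2 ^ j)\<close>.\<close>

lemma sq_norm_target_ge_sum:
  assumes [measurable]: "h \<in> borel_measurable borel"
  shows "(\<Sum>j=1..d. ennreal ((1/2) ^ j * (h (real j))\<^sup>2)) \<le> sq_norm_L2 (distribution_of geometric_base target_density) h"
proof -
  have "(\<Sum>j=1..d. ennreal ((1/2) ^ j * (h (real j))\<^sup>2))
      = (\<Sum>k=1..d. ennreal (if k = 0 then 0 else (1/2) ^ k * (h (real k))\<^sup>2))"
    by (intro sum.cong) auto
  also have "\<dots> \<le> sq_norm_L2 (distribution_of geometric_base target_density) h"
    unfolding sq_norm_target[OF assms] by (intro sum_le_suminf) auto
  finally show ?thesis .
qed

lemma sq_norm_target_spike:
  assumes "1 \<le> j"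
  shows "sq_norm_L2 (distribution_of geometric_base target_density) (spike j) = 1"
proof -
  have "(\<lambda>k. ennreal (if k = 0 then 0 else (1/2) ^ k * (spike j (real k))\<^sup>2))
      = (\<lambda>k. if k = j then 1 else 0)"
    using assms by (auto simp: spike_def power_one_over)
  then show ?thesis
    unfolding sq_norm_target[OF measurable_spike]
    using suminf_finite[of "{j}" "\<lambda>k. if k = j then 1 else 0 :: ennreal"] by simp
qed

text \<open>Disjoint supports give orthogonality. Up to null sets of the target a function is
  determined by its values on the positive atoms, so truncating its expansion leaves the tail of a
  convergent series.\<close>

lemma orthonormal_basis_spike: "orthonormal_basis_L2 (distribution_of geometric_base target_density) spike"
  unfolding orthonormal_basis_L2_def
proof (intro conjI allI impI ballI)
  fix j :: nat assume "1 \<le> j"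
  then show "spike j \<in> L2_functions (distribution_of geometric_base target_density)"
    by (simp add: L2_functions_def sq_norm_target_spike)
next
  fix i j :: nat assume ij: "1 \<le> i" "1 \<le> j"
  show "(\<integral>x. spike i x * spike j x \<partial>distribution_of geometric_base target_density) = (if i = j then 1 else 0)"
  proof (cases "i = j")
    case True
    have "(\<integral>x. (spike j x)\<^sup>2 \<partial>distribution_of geometric_base target_density) = 1"
      using sq_norm_target_spike[OF ij(2)] unfolding sq_norm_L2_def
      by (subst integral_eq_nn_integral) auto
    then show ?thesis using True by (simp add: power2_eq_square)
  next
    case False
    then have "(\<lambda>x. spike i x * spike j x) = (\<lambda>x. 0)" by (auto simp: spike_def)
    then show ?thesis using False by (simp only:) simp
  qed
next
  fix f and \<epsilon> :: real
  assume f: "f \<in> L2_functions (distribution_of geometric_base target_density)" and \<epsilon>: "0 < \<epsilon>"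
  have [measurable]: "f \<in> borel_measurable borel"
    using f by (auto simp: L2_functions_def)
  define F where "F k = (if k = 0 then 0 else (1/2) ^ k * (f (real k))\<^sup>2)" for k :: nat
  have F_nn: "0 \<le> F k" for k by (simp add: F_def)
  have "(\<Sum>k. ennreal (F k)) < \<infinity>"
    using f sq_norm_target[of f] by (auto simp: L2_functions_def F_def)
  then have summ: "summable F"
    using F_nn by (intro summable_suminf_not_top) auto
  obtain N where N: "\<And>n. n \<ge> N \<Longrightarrow> norm (\<Sum>i. F (i + n)) < \<epsilon>\<^sup>2"
    using suminf_exist_split[OF _ summ, of "\<epsilon>\<^sup>2"] \<epsilon> by auto
  have summG: "summable (\<lambda>k. if k \<le> N then 0 else F k)"
    by (rule summable_comparison_test'[OF summ, of 0]) (auto simp: F_nn)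
  \<comment> \<open>The coefficient of \<open>f\<close> along \<open>spike j\<close>; the partial
    sum then equals \<open>f\<close> on the atoms 1 to \<open>N\<close>.\<close>
  define a where "a j = f (real j) / sqrt (2 ^ j)" for j
  define h where "h x = f x - (\<Sum>j=1..N. a j * spike j x)" for x
  have [measurable]: "h \<in> borel_measurable borel" unfolding h_def by measurable
  have h_at: "h (real k) = (if 1 \<le> k \<and> k \<le> N then 0 else f (real k))" for k
  proof -
    have "(\<Sum>j=1..N. a j * spike j (real k)) = (\<Sum>j=1..N. if j = k then f (real k) else 0)"
      by (intro sum.cong) (auto simp: a_def spike_def)
    then show ?thesis by (simp add: h_def)
  qed
  have "sq_norm_L2 (distribution_of geometric_base target_density) h
      = (\<Sum>k. ennreal (if k \<le> N then 0 else F k))"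
    unfolding sq_norm_target[OF \<open>h \<in> borel_measurable borel\<close>]
    by (intro suminf_cong arg_cong[where f = ennreal]) (auto simp: h_at F_def)
  also have "\<dots> = ennreal (\<Sum>k. if k \<le> N then 0 else F k)"
    using summG by (intro suminf_ennreal2) (auto simp: F_nn)
  \<comment> \<open>The tail starts at \<open>Suc N\<close> because atom \<open>N\<close> is matched
    exactly; the choice of \<open>N\<close> bounds all later tails as well.\<close>
  also have "(\<Sum>k. if k \<le> N then 0 else F k) = (\<Sum>k. F (k + Suc N))"
    using suminf_split_initial_segment[OF summG, of "Suc N"] by simp
  also have "\<dots> < ennreal (\<epsilon>\<^sup>2)"
    using N[of "Suc N"] \<epsilon> by (intro ennreal_lessI) auto
  finally show "\<exists>N a. sq_norm_L2 (distribution_of geometric_base target_density)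
      (\<lambda>x. f x - (\<Sum>j=1..N. a j * spike j x)) < ennreal (\<epsilon>\<^sup>2)"
    unfolding h_def by blast
qed

text \<open>At each point at most one index contributes, whatever the eigenvalues are.\<close>

lemma kernel_converges_spike: "kernel_converges spike \<mu>"
  unfolding kernel_converges_def
proof (intro allI)
  fix x x' :: real
  have fin: "finite {j. real j = x}"
    by (rule finite_subset[of _ "{nat \<lfloor>x\<rfloor>}"]) auto
  have "(\<lambda>j. \<mu> j * spike j x * spike j x') summable_on {j. real j = x} \<inter> {1..}"
    using fin by (intro summable_on_finite) auto
  then show "(\<lambda>j. \<mu> j * spike j x * spike j x') summable_on {1..}"
    by (rule summable_on_cong_neutral[THEN iffD1, rotated -1]) (auto simp: spike_def)
qed

lemma finite_expansion_in_hilbert_ball: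
  assumes pos: "\<And>j. j \<in> {1..d} \<Longrightarrow> 0 < \<mu> j" and le: "(\<Sum>j=1..d. (\<theta> j)\<^sup>2 / \<mu> j) \<le> r\<^sup>2"
  shows "(\<lambda>x. \<Sum>j=1..d. \<theta> j * \<phi> j x) \<in> hilbert_ball \<phi> \<mu> r"
proof -
  \<comment> \<open>Extension by 0 makes the coefficients vanish wherever \<open>\<mu>\<close> does,
    and the added terms are 0, including those of the form \<open>0 / 0\<close>.\<close>
  define \<theta>' where "\<theta>' j = (if j \<in> {1..d} then \<theta> j else 0)" for j
  have sq: "((\<lambda>j. (\<theta>' j)\<^sup>2 / \<mu> j) has_sum (\<Sum>j=1..d. (\<theta> j)\<^sup>2 / \<mu> j)) {1..}"
    by (rule has_sum_cong_neutral[THEN iffD1, OF _ _ _ has_sum_finite[of "{1..d}"]]) (auto simp: \<theta>'_def)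
  have "((\<lambda>j. \<theta>' j * \<phi> j x) has_sum (\<Sum>j=1..d. \<theta> j * \<phi> j x)) {1..}" for x
    by (rule has_sum_cong_neutral[THEN iffD1, OF _ _ _ has_sum_finite[of "{1..d}"]]) (auto simp: \<theta>'_def)
  then have "hilbert_expansion \<phi> \<mu> (\<lambda>x. \<Sum>j=1..d. \<theta> j * \<phi> j x) \<theta>'"
    using sq has_sum_imp_summable[OF sq] pos unfolding hilbert_expansion_def
    by (metis \<theta>'_def less_irrefl)
  then show ?thesis
    using infsumI[OF sq] le unfolding hilbert_ball_def by auto
qed

text \<open>Assouad's pairing: with subsets read as sign vectors, each one not containing
  \<open>a\<close> meets its neighbour across coordinate \<open>a\<close>.\<close>

lemma sum_Pow_insert:
  fixes F :: "'a set \<Rightarrow> 'b :: comm_monoid_add"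
  assumes "finite A" "a \<notin> A"
  shows "sum F (Pow (insert a A)) = (\<Sum>S\<in>Pow A. F S + F (insert a S))"
proof -
  have "inj_on (insert a) (Pow A)"
    using assms(2) by (auto simp: inj_on_def)
  then have "sum F (insert a ` Pow A) = (\<Sum>S\<in>Pow A. F (insert a S))"
    by (simp add: sum.reindex)
  moreover have "Pow A \<inter> insert a ` Pow A = {}" using assms(2) by auto
  ultimately show ?thesis
    using assms(1) by (simp add: Pow_insert sum.union_disjoint sum.distrib)
qed

section \<open>The Assouad lower bound\<close>

text \<open>Subsets \<open>S\<close> of \<open>{1..d}\<close> encode sign vectors. Two neighbours
  across coordinate \<open>j\<close> have total loss at least \<open>\<tau>\<^sup>2\<close> there,
  so the average over the hypercube is at least \<open>\<tau>\<^sup>2 / 2\<close> per coordinate.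
  With \<open>\<tau>\<^sup>2 = s / 2\<close> this sums to \<open>d * s / 4\<close>.\<close>

lemma spike_minimax_lower_bound:
  assumes B: "1 \<le> B" and \<sigma>: "0 < \<sigma>" and n: "1 \<le> n" and d: "1 \<le> d"
    and pos: "\<And>j. j \<in> {1..d} \<Longrightarrow> 0 < \<mu> j"
    and mono: "\<And>j. j \<in> {1..d} \<Longrightarrow> \<mu> d \<le> \<mu> j"
    and le: "real d * (\<sigma>\<^sup>2 * B / real n) \<le> \<mu> d"
  defines "\<nu> \<equiv> density lborel (normal_density 0 \<sigma>)"
  shows "ennreal (real d * (\<sigma>\<^sup>2 * B / real n) / 4) \<le>
    minimax_risk n (distribution_of geometric_base (source_density B)) (distribution_of geometric_base target_density) \<nu> (hilbert_ball spike \<mu> 1)"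
  unfolding minimax_risk_def
proof (rule INF_greatest)
  define P where "P = distribution_of geometric_base (source_density B)"
  define Q where "Q = distribution_of geometric_base target_density"
  define s where "s = \<sigma>\<^sup>2 * B / real n"
  have s: "0 < s" using B \<sigma> n by (simp add: s_def)
  \<comment> \<open>The largest amplitude that the two-point bound admits: flipping one sign moves
    the function by \<open>4 * \<tau>\<^sup>2 / B = 2 * \<sigma>\<^sup>2 / n\<close> in squared norm
    under \<open>P\<close>.\<close>
  define \<tau> where "\<tau> = sqrt (s / 2)"
  have \<tau>: "\<tau>\<^sup>2 = s / 2" using s by (simp add: \<tau>_def)
  have P: "prob_space P"
    unfolding P_def by (intro prob_space_distribution_of probability_density_source B)
  have [measurable_cong]: "sets P = sets borel" by (simp add: P_def)
  have spaceP: "space P = UNIV" by (simp add: P_def distribution_of_def)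
  define \<theta> where "\<theta> S j = (if j \<in> S then \<tau> else - \<tau>)" for S and j :: nat
  define f where "f S x = (\<Sum>j=1..d. \<theta> S j * spike j x)" for S x
  have f_meas[measurable]: "f S \<in> borel_measurable borel" for S
    unfolding f_def by measurable
  have f_meas_P: "f S \<in> borel_measurable P" for S
    by measurable
  have f_at: "f S (real k) = \<theta> S k * sqrt (2 ^ k)" if "k \<in> {1..d}" for S k
  proof -
    have "f S (real k) = (\<Sum>j=1..d. if j = k then \<theta> S k * sqrt (2 ^ k) else 0)"
      unfolding f_def by (intro sum.cong) (auto simp: spike_def)
    then show ?thesis using that by simp
  qed
  have f_ball: "f S \<in> hilbert_ball spike \<mu> 1" for S
    unfolding f_def
  proof (rule finite_expansion_in_hilbert_ball)
    \<comment> \<open>\<open>\<mu> d\<close> is the least eigenvalue involved, and \<open>le\<close>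
      then makes the squared Hilbert norm at most 1/2.\<close>
    have "(\<Sum>j=1..d. (\<theta> S j)\<^sup>2 / \<mu> j) \<le> (\<Sum>j=1..d. (s / 2) / \<mu> d)"
    proof (rule sum_mono)
      fix j assume j: "j \<in> {1..d}"
      have "(\<theta> S j)\<^sup>2 = s / 2" using \<tau> by (simp add: \<theta>_def)
      then show "(\<theta> S j)\<^sup>2 / \<mu> j \<le> (s / 2) / \<mu> d"
        using s mono[OF j] pos[OF j] pos[of d] d by (auto intro!: divide_left_mono)
    qed
    also have "\<dots> \<le> 1\<^sup>2"
    proof -
      have "real d * s \<le> \<mu> d" using le by (simp only: s_def)
      then have "real d * s \<le> \<mu> d * 2" using pos[of d] d by simp
      then show ?thesis using pos[of d] d by (simp add: field_simps)
    qed
    finally show "(\<Sum>j=1..d. (\<theta> S j)\<^sup>2 / \<mu> j) \<le> 1\<^sup>2" .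
  qed (rule pos)

  fix fh assume fh: "fh \<in> estimators n (distribution_of geometric_base (source_density B))"
  then have fh_meas[measurable]: "(\<lambda>(D, x). fh D x) \<in> borel_measurable ((\<Pi>\<^sub>M i\<in>{..<n}. P \<Otimes>\<^sub>M borel) \<Otimes>\<^sub>M P)"
    by (simp add: estimators_def P_def)
  \<comment> \<open>The coefficient of the estimate along \<open>spike j\<close>, read off at the
    atom \<open>j\<close>.\<close>
  define T where "T j D = fh D (real j) / sqrt (2 ^ j)" for j D
  have T_meas: "T j \<in> borel_measurable (\<Pi>\<^sub>M i\<in>{..<n}. P \<Otimes>\<^sub>M borel)" for j
  proof -
    have "(\<lambda>D. (\<lambda>(D, x). fh D x) (D, real j)) \<in> borel_measurable (\<Pi>\<^sub>M i\<in>{..<n}. P \<Otimes>\<^sub>M borel)"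
      by (rule measurable_compose[OF _ fh_meas]) (simp add: spaceP)
    then show ?thesis unfolding T_def by simp
  qed
  have sets_law: "sets (sample_law n P \<nu> h) = sets (\<Pi>\<^sub>M i\<in>{..<n}. P \<Otimes>\<^sub>M borel)" for h
    unfolding sample_law_def by (intro sets_PiM_cong) (auto simp: observation_law_def)
  have T_meas'[measurable]: "T j \<in> borel_measurable (sample_law n P \<nu> h)" for j h
    using T_meas measurable_cong_sets[OF sets_law refl] by blast
  define X where "X S j = (\<integral>\<^sup>+D. ennreal ((T j D - \<theta> S j)\<^sup>2) \<partial>sample_law n P \<nu> (f S))" for S j
  have risk_ge: "(\<Sum>j=1..d. X S j) \<le> risk n P Q \<nu> fh (f S)" for S
  proof -
    have "(\<Sum>j=1..d. X S j) = (\<integral>\<^sup>+D. (\<Sum>j=1..d. ennreal ((T j D - \<theta> S j)\<^sup>2)) \<partial>sample_law n P \<nu> (f S))"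
      unfolding X_def by (subst nn_integral_sum) auto
    also have "\<dots> \<le> (\<integral>\<^sup>+D. sq_norm_L2 Q (\<lambda>x. fh D x - f S x) \<partial>sample_law n P \<nu> (f S))"
    proof (rule nn_integral_mono)
      fix D assume "D \<in> space (sample_law n P \<nu> (f S))"
      then have D: "D \<in> space (\<Pi>\<^sub>M i\<in>{..<n}. P \<Otimes>\<^sub>M borel)"
        using sets_eq_imp_space_eq[OF sets_law] by blast
      have "fh D \<in> borel_measurable P"
        using measurable_Pair2[OF fh_meas D] by simp
      then have [measurable]: "fh D \<in> borel_measurable borel"
        by (simp cong: measurable_cong_sets)
      have "(\<Sum>j=1..d. ennreal ((T j D - \<theta> S j)\<^sup>2))
          = (\<Sum>j=1..d. ennreal ((1/2) ^ j * (fh D (real j) - f S (real j))\<^sup>2))"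
      proof (intro sum.cong refl arg_cong[where f = ennreal])
        fix j assume j: "j \<in> {1..d}"
        have "fh D (real j) - f S (real j) = sqrt (2 ^ j) * (T j D - \<theta> S j)"
          by (simp add: f_at[OF j] T_def right_diff_distrib)
        then show "(T j D - \<theta> S j)\<^sup>2 = (1/2) ^ j * (fh D (real j) - f S (real j))\<^sup>2"
          by (simp add: power_mult_distrib power_one_over)
      qed
      also have "\<dots> \<le> sq_norm_L2 Q (\<lambda>x. fh D x - f S x)"
        unfolding Q_def by (rule sq_norm_target_ge_sum) measurable
      finally show "(\<Sum>j=1..d. ennreal ((T j D - \<theta> S j)\<^sup>2)) \<le> sq_norm_L2 Q (\<lambda>x. fh D x - f S x)" .
    qed
    finally show ?thesis by (simp add: risk_def)
  qed

  have pair: "ennreal (\<tau>\<^sup>2) \<le> X S j + X (insert j S) j" if j: "j \<in> {1..d}" and S: "j \<notin> S" for S j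
  proof -
    have diff: "f S x - f (insert j S) x = - (2 * \<tau>) * spike j x" for x
    proof -
      have "f S x - f (insert j S) x = (\<Sum>i=1..d. (\<theta> S i - \<theta> (insert j S) i) * spike i x)"
        by (simp add: f_def sum_subtractf left_diff_distrib)
      also have "\<dots> = (\<Sum>i=1..d. if i = j then - (2 * \<tau>) * spike j x else 0)"
        using S by (intro sum.cong) (auto simp: \<theta>_def)
      finally show ?thesis using j by simp
    qed
    have "(\<integral>\<^sup>+x. ennreal ((f S x - f (insert j S) x)\<^sup>2) \<partial>P)
        = (\<integral>\<^sup>+x. ennreal (4 * \<tau>\<^sup>2) * ennreal ((spike j x)\<^sup>2) \<partial>P)"
      by (intro nn_integral_cong) (simp add: diff ennreal_mult[symmetric] power_mult_distrib)
    also have "\<dots> = ennreal (4 * \<tau>\<^sup>2) * (\<integral>\<^sup>+x. ennreal ((spike j x)\<^sup>2) \<partial>P)"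
      by (rule nn_integral_cmult) measurable
    \<comment> \<open>The source sees the spike with weight \<open>1 / B\<close> only, which cancels
      the \<open>B\<close> inside \<open>s\<close>.\<close>
    also have "(\<integral>\<^sup>+x. ennreal ((spike j x)\<^sup>2) \<partial>P) = ennreal (1 / B) * sq_norm_L2 Q (spike j)"
      unfolding P_def Q_def sq_norm_L2_def using B j
      by (intro nn_integral_source) (auto simp: spike_def)
    also have "sq_norm_L2 Q (spike j) = 1"
      unfolding Q_def using j by (intro sq_norm_target_spike) auto
    also have "ennreal (4 * \<tau>\<^sup>2) * (ennreal (1 / B) * 1) = ennreal (4 * \<tau>\<^sup>2 * (1 / B))"
      using B by (simp only: mult_1_right) (rule ennreal_mult[symmetric], auto)
    also have "4 * \<tau>\<^sup>2 * (1 / B) = 2 * \<sigma>\<^sup>2 / real n"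
      using B by (simp add: \<tau> s_def)
    finally have close: "(\<integral>\<^sup>+x. ennreal ((f S x - f (insert j S) x)\<^sup>2) \<partial>P) \<le> ennreal (2 * \<sigma>\<^sup>2 / real n)"
      by simp
    show ?thesis
      \<comment> \<open>With \<open>u = - \<tau>\<close> and \<open>v = \<tau>\<close>, the quantity
        \<open>(u - v)^2 / 4\<close> is \<open>\<tau>\<^sup>2\<close>.\<close>
      using sample_two_point_bound[OF P f_meas_P f_meas_P \<sigma> n close T_meas[of j], of "- \<tau>" \<tau>] S
      by (simp add: X_def \<theta>_def \<nu>_def)
  qed

  define K where "K = {1..d}"
  have K: "finite K" "card K = d" by (auto simp: K_def)
  \<comment> \<open>For fixed \<open>j\<close> the hypercube splits into \<open>2 ^ (d - 1)\<close>
    pairs of neighbours, each contributing at least \<open>\<tau>\<^sup>2\<close>.\<close>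
  have coord: "ennreal (2 ^ (d - 1) * \<tau>\<^sup>2) \<le> (\<Sum>S\<in>Pow K. X S j)" if j: "j \<in> K" for j
  proof -
    have "ennreal (2 ^ (d - 1) * \<tau>\<^sup>2) = (\<Sum>S\<in>Pow (K - {j}). ennreal (\<tau>\<^sup>2))"
      using K j by (simp add: card_Pow ennreal_mult ennreal_of_nat_eq_real_of_nat)
    also have "\<dots> \<le> (\<Sum>S\<in>Pow (K - {j}). X S j + X (insert j S) j)"
      using j by (intro sum_mono pair) (auto simp: K_def)
    also have "\<dots> = (\<Sum>S\<in>Pow (insert j (K - {j})). X S j)"
      using K by (intro sum_Pow_insert[symmetric]) auto
    finally show ?thesis using j by (simp add: insert_absorb)
  qed
  let ?R = "SUP g\<in>hilbert_ball spike \<mu> 1. risk n P Q \<nu> fh g"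
  have pow: "(2::real) ^ d = 2 ^ (d - 1) * 2"
    using d by (cases d) auto
  \<comment> \<open>The worst-case risk dominates the average over the hypercube. The factor
    \<open>2 ^ d\<close> is kept on both sides and cancelled at the end, where finiteness is
    available.\<close>
  have "ennreal (real d * s / 4 * 2 ^ d) = (\<Sum>j\<in>K. ennreal (2 ^ (d - 1) * \<tau>\<^sup>2))"
    using K s by (subst sum_ennreal) (auto simp: \<tau> pow)
  also have "\<dots> \<le> (\<Sum>j\<in>K. \<Sum>S\<in>Pow K. X S j)"
    by (intro sum_mono coord)
  also have "\<dots> = (\<Sum>S\<in>Pow K. \<Sum>j\<in>K. X S j)"
    by (rule sum.swap)
  also have "\<dots> \<le> (\<Sum>S\<in>Pow K. ?R)"
  proof (rule sum_mono)
    fix S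
    have "risk n P Q \<nu> fh (f S) \<le> ?R" by (rule SUP_upper) (rule f_ball)
    then show "(\<Sum>j\<in>K. X S j) \<le> ?R"
      unfolding K_def by (rule order.trans[OF risk_ge])
  qed
  also have "\<dots> = ?R * ennreal (2 ^ d)"
    using K by (simp add: card_Pow mult.commute ennreal_power[symmetric])
  finally have main: "ennreal (real d * s / 4 * 2 ^ d) \<le> ?R * ennreal (2 ^ d)" .
  have "ennreal (real d * s / 4) \<le> ?R"
  proof (cases ?R)
    case (real r)
    then have "ennreal (real d * s / 4 * 2 ^ d) \<le> ennreal (r * 2 ^ d)"
      using main by (simp add: ennreal_mult[symmetric] del: ennreal_power)
    then have "real d * s / 4 * 2 ^ d \<le> r * 2 ^ d"
      using real by (subst (asm) ennreal_le_iff) auto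
    then show ?thesis using real by (simp add: ennreal_leI)
  next
    case top
    show ?thesis unfolding top by (rule top_greatest)
  qed
  then show "ennreal (real d * (\<sigma>\<^sup>2 * B / real n) / 4)
      \<le> (SUP g\<in>hilbert_ball spike \<mu> 1. risk n (distribution_of geometric_base (source_density B)) (distribution_of geometric_base target_density) \<nu> fh g)"
    by (simp add: P_def Q_def s_def)
qed

section \<open>The critical dimension and the final bound\<close>

text \<open>Maximality of \<open>d\<close> gives \<open>\<mu> (Suc d) <= (d + 1) * s\<close>. At
  \<open>\<delta>\<^sup>2 = (d + 1) * s\<close> the dimension is therefore at most
  \<open>d + 1\<close>, and each of the two terms is at most \<open>2 * d * s\<close> because
  \<open>1 <= d\<close>.\<close>

lemma critical_dimension:
  fixes \<mu> :: "nat \<Rightarrow> real"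
  assumes mono: "\<And>i j. 1 \<le> i \<Longrightarrow> i \<le> j \<Longrightarrow> \<mu> j \<le> \<mu> i" and s: "0 < s" "s \<le> \<mu> 1"
  obtains d where "1 \<le> d" "real d * s \<le> \<mu> d"
    "(INF \<delta>\<in>{0<..}. \<delta>\<^sup>2 + s * real (eigenvalue_dim \<mu> \<delta>)) \<le> 4 * (real d * s)"
proof -
  define A where "A = {d. 1 \<le> d \<and> real d * s \<le> \<mu> d}"
  \<comment> \<open>Members of \<open>A\<close> are bounded because
    \<open>d * s <= \<mu> d <= \<mu> 1\<close>.\<close>
  have "d \<le> nat \<lceil>\<mu> 1 / s\<rceil>" if "d \<in> A" for d
  proof -
    have "real d * s \<le> \<mu> 1" using that mono[of 1 d] by (auto simp: A_def)
    then have "real d \<le> \<mu> 1 / s" using s by (simp add: field_simps)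
    then show ?thesis by linarith
  qed
  then have fin: "finite A" by (intro finite_subset[of A "{..nat \<lceil>\<mu> 1 / s\<rceil>}"]) auto
  define d where "d = Max A"
  \<comment> \<open>The assumption \<open>s <= \<mu> 1\<close> is exactly what puts 1 into
    \<open>A\<close>.\<close>
  have "1 \<in> A" using s by (simp add: A_def)
  then have "d \<in> A" unfolding d_def using fin by (intro Max_in) auto
  then have d: "1 \<le> d" "real d * s \<le> \<mu> d" by (auto simp: A_def)
  have "Suc d \<notin> A" using Max_ge[OF fin, of "Suc d"] by (auto simp: d_def)
  then have next_small: "\<mu> (Suc d) \<le> real (Suc d) * s" by (simp add: A_def)
  define \<delta> where "\<delta> = sqrt (real (Suc d) * s)"
  have \<delta>: "0 < \<delta>" "\<delta>\<^sup>2 = real (Suc d) * s" using s by (auto simp: \<delta>_def)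
  have dim: "eigenvalue_dim \<mu> \<delta> \<le> Suc d"
    unfolding eigenvalue_dim_def \<delta>(2) using next_small by (intro Least_le) auto
  have "(INF \<delta>\<in>{0<..}. \<delta>\<^sup>2 + s * real (eigenvalue_dim \<mu> \<delta>)) \<le> \<delta>\<^sup>2 + s * real (eigenvalue_dim \<mu> \<delta>)"
    using \<delta> s by (intro cINF_lower bdd_belowI2[of _ 0]) auto
  also have "\<dots> \<le> real (Suc d) * s + s * real (Suc d)"
    unfolding \<delta>(2) using dim s by (intro add_left_mono mult_left_mono) auto
  also have "\<dots> = 2 * s * (real d + 1)" by (simp add: algebra_simps)
  also have "\<dots> \<le> 2 * s * (2 * real d)" using d s by (intro mult_left_mono) auto
  also have "\<dots> = 4 * (real d * s)" by simp
  finally show thesis using d by (intro that[of d])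
qed

text \<open>Serves the noiseless case, where the variance term drops out. The infimum is over
  positive \<open>\<delta>\<close> and is not attained.\<close>

lemma INF_square_eq_zero: "(INF \<delta>\<in>{0<..}. \<delta>\<^sup>2 :: real) = 0"
proof (rule antisym)
  show "(INF \<delta>\<in>{0<..}. \<delta>\<^sup>2 :: real) \<le> 0"
  proof (rule field_le_epsilon)
    fix e :: real assume "0 < e"
    then have "(INF \<delta>\<in>{0<..}. \<delta>\<^sup>2) \<le> (sqrt e)\<^sup>2"
      by (intro cINF_lower bdd_belowI2[of _ 0]) auto
    then show "(INF \<delta>\<in>{0<..}. \<delta>\<^sup>2) \<le> 0 + e" using \<open>0 < e\<close> by simp
  qed
  show "0 \<le> (INF \<delta>\<in>{0<..}. \<delta>\<^sup>2 :: real)"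
    by (rule cINF_greatest) auto
qed

text \<open>The condition \<open>\<sigma>\<^sup>2 * B / n <= \<mu> 1\<close> excludes overwhelming
  noise: the zero estimator has risk at most \<open>\<mu> 1\<close> on the unit ball of this
  construction, while the infimum over \<open>\<delta>\<close> is at least
  \<open>\<sigma>\<^sup>2 * B / n\<close>. The noise law depends on \<open>\<sigma>\<close>
  alone.\<close>

theorem theorem2:
  "\<exists>c::real. c > 0 \<and>
    (\<forall>B::real. B \<ge> 1 \<longrightarrow>
      (\<exists>(M :: real measure) (p :: real \<Rightarrow> real) (q :: real \<Rightarrow> real) (\<phi> :: nat \<Rightarrow> real \<Rightarrow> real).
        sigma_finite_measure M \<and> sets M = sets borel \<and>
        probability_density M p \<and> probability_density M q \<and>
        bounded_likelihood_ratio B p q \<and>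
        orthonormal_basis_L2 (distribution_of M q) \<phi> \<and>
        (\<forall>\<sigma>::real. \<sigma> \<ge> 0 \<longrightarrow>
          (\<exists>\<nu> :: real measure. centered_sub_gaussian \<sigma> \<nu> \<and>
            (\<forall>(c\<^sub>0 :: real) (\<mu> :: nat \<Rightarrow> real). c\<^sub>0 > 0 \<and> regular_eigenvalues c\<^sub>0 \<mu> \<longrightarrow>
              kernel_converges \<phi> \<mu> \<and>
              (\<forall>n::nat. n \<ge> 1 \<and> \<sigma>\<^sup>2 * B / real n \<le> \<mu> 1 \<longrightarrow>
                minimax_risk n (distribution_of M p) (distribution_of M q) \<nu> (hilbert_ball \<phi> \<mu> 1)
                  \<ge> ennreal (c * (INF \<delta>\<in>{0<..}.
                        \<delta>\<^sup>2 + \<sigma>\<^sup>2 * B * real (eigenvalue_dim \<mu> \<delta>) / real n))))))))"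
\<comment> \<open>The risk is at least \<open>d * s / 4\<close> and the infimum at most
  \<open>4 * d * s\<close>, whence the ratio 1/16.\<close>
proof (intro exI[of _ "1/16"] conjI allI impI)
  show "(0::real) < 1/16" by simp
  fix B :: real assume B: "1 \<le> B"
  have noise: "\<exists>\<nu> :: real measure. centered_sub_gaussian \<sigma> \<nu> \<and>
      (\<forall>(c\<^sub>0 :: real) (\<mu> :: nat \<Rightarrow> real). c\<^sub>0 > 0 \<and> regular_eigenvalues c\<^sub>0 \<mu> \<longrightarrow>
        kernel_converges spike \<mu> \<and>
        (\<forall>n::nat. n \<ge> 1 \<and> \<sigma>\<^sup>2 * B / real n \<le> \<mu> 1 \<longrightarrow>
          minimax_risk n (distribution_of geometric_base (source_density B)) (distribution_of geometric_base target_density) \<nu> (hilbert_ball spike \<mu> 1)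
            \<ge> ennreal (1/16 * (INF \<delta>\<in>{0<..}.
                  \<delta>\<^sup>2 + \<sigma>\<^sup>2 * B * real (eigenvalue_dim \<mu> \<delta>) / real n))))"
    if "0 \<le> \<sigma>" for \<sigma> :: real
  proof (cases "\<sigma> = 0")
    \<comment> \<open>Without noise the right-hand side is 0. The point mass at 0 replaces the
      Gaussian, whose density formula degenerates at \<open>\<sigma> = 0\<close>.\<close>
    case True
    then show ?thesis
      by (auto intro!: exI[of _ "return borel 0"]
          simp: point_mass_centered_sub_gaussian kernel_converges_spike INF_square_eq_zero)
  next
    case False
    then have \<sigma>: "0 < \<sigma>" using that by simp
    let ?\<nu> = "density lborel (normal_density 0 \<sigma>)"
    have "ennreal (1/16 * (INF \<delta>\<in>{0<..}. \<delta>\<^sup>2 + \<sigma>\<^sup>2 * B * real (eigenvalue_dim \<mu> \<delta>) / real n))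
      \<le> minimax_risk n (distribution_of geometric_base (source_density B)) (distribution_of geometric_base target_density) ?\<nu> (hilbert_ball spike \<mu> 1)"
      if reg: "regular_eigenvalues c\<^sub>0 \<mu>" and n: "1 \<le> n" and le: "\<sigma>\<^sup>2 * B / real n \<le> \<mu> 1"
      for c\<^sub>0 \<mu> and n :: nat
    proof -
      define s where "s = \<sigma>\<^sup>2 * B / real n"
      have s: "0 < s" "s \<le> \<mu> 1" using B \<sigma> n le by (auto simp: s_def)
      have mono: "\<mu> j \<le> \<mu> i" if "1 \<le> i" "i \<le> j" for i j
        using reg that by (auto simp: regular_eigenvalues_def)
      obtain d where d: "1 \<le> d" "real d * s \<le> \<mu> d"
        and inf: "(INF \<delta>\<in>{0<..}. \<delta>\<^sup>2 + s * real (eigenvalue_dim \<mu> \<delta>)) \<le> 4 * (real d * s)"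
        using critical_dimension[of \<mu> s] mono s by blast
      \<comment> \<open>Positivity passes from \<open>d * s\<close> to \<open>\<mu> d\<close>, and
        by monotonicity to all eigenvalues of the first \<open>d\<close> coordinates.\<close>
      have "0 < real d * s" using d s by simp
      then have pos: "0 < \<mu> j" if "j \<in> {1..d}" for j
        using that mono[of j d] d by auto
      have "ennreal (1/16 * (INF \<delta>\<in>{0<..}. \<delta>\<^sup>2 + s * real (eigenvalue_dim \<mu> \<delta>)))
          \<le> ennreal (real d * s / 4)"
        using inf by (intro ennreal_leI) simp
      also have "\<dots> \<le> minimax_risk n (distribution_of geometric_base (source_density B)) (distribution_of geometric_base target_density) ?\<nu>
          (hilbert_ball spike \<mu> 1)"
        unfolding s_def using d mono
        by (intro spike_minimax_lower_bound B \<sigma> n pos) (auto simp: s_def)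
      finally show ?thesis by (simp add: s_def)
    qed
    then show ?thesis
      using normal_centered_sub_gaussian[OF \<sigma>] kernel_converges_spike by blast
  qed
  show "\<exists>(M :: real measure) (p :: real \<Rightarrow> real) (q :: real \<Rightarrow> real) (\<phi> :: nat \<Rightarrow> real \<Rightarrow> real).
        sigma_finite_measure M \<and> sets M = sets borel \<and>
        probability_density M p \<and> probability_density M q \<and>
        bounded_likelihood_ratio B p q \<and>
        orthonormal_basis_L2 (distribution_of M q) \<phi> \<and>
        (\<forall>\<sigma>::real. \<sigma> \<ge> 0 \<longrightarrow>
          (\<exists>\<nu> :: real measure. centered_sub_gaussian \<sigma> \<nu> \<and>
            (\<forall>(c\<^sub>0 :: real) (\<mu> :: nat \<Rightarrow> real). c\<^sub>0 > 0 \<and> regular_eigenvalues c\<^sub>0 \<mu> \<longrightarrow>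
              kernel_converges \<phi> \<mu> \<and>
              (\<forall>n::nat. n \<ge> 1 \<and> \<sigma>\<^sup>2 * B / real n \<le> \<mu> 1 \<longrightarrow>
                minimax_risk n (distribution_of M p) (distribution_of M q) \<nu> (hilbert_ball \<phi> \<mu> 1)
                  \<ge> ennreal (1/16 * (INF \<delta>\<in>{0<..}.
                        \<delta>\<^sup>2 + \<sigma>\<^sup>2 * B * real (eigenvalue_dim \<mu> \<delta>) / real n))))))"
    by (intro exI[of _ geometric_base] exI[of _ "source_density B"] exI[of _ target_density] exI[of _ spike] conjI allI impI
        noise prob_space_imp_sigma_finite prob_space_base sets_base probability_density_source[OF B]
        probability_density_target bounded_likelihood_ratio_source_target[OF B] orthonormal_basis_spike)
qed

end
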